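(* Let $(\gamma_n)_{n\in\mathbb{N}}$ and $(\delta_n)_{n\in\mathbb{N}}$ be sequences of independent random variables, each uniformly distributed (with respect to Lebesgue measure) in $[0,1)$. Let $\psi:\mathbb{N}\to[0,\infty)$ be a decreasing function and suppose that for some $\epsilon>0$, \[\limsup_{n\to\infty}\frac{1}{n^{4+\epsilon}}\exp\left((4-\epsilon)\sum_{m=1}^{n}\psi(m)\log\frac{1}{\psi(m)}\right)=\infty.\] Then almost surely (with respect to the values of $(\gamma_n)$ and $(\delta_n)$) the following holds: for all $\alpha,\beta\in\mathbb{R}$ there are infinitely many triples $(n,a,b)$ with $n\in\mathbb{N}$ and $a,b\in\mathbb{Z}$ such that \[\left|\alpha+\frac{\gamma_n}{n}-\frac{a}{n}\right|\cdot\left|\beta+\frac{\delta_n}{n}-\frac{b}{n}\right|\le\frac{\psi(n)}{n^2}.\]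
   Context: The random variables $\gamma_1,\gamma_2,\dots,\delta_1,\delta_2,\dots$ are all mutually independent. "Decreasing" means non-increasing. In the displayed hypothesis, the summand $\psi(m)\log(1/\psi(m))$ is to be interpreted as $0$ when $\psi(m)=0$. *)

theory Defs
  imports "HOL-Probability.Probability"
begin

end

theory Submission
  imports Defs "HOL-Real_Asymp.Real_Asymp"
begin

text \<open>
  For fixed \<open>(\<alpha>, \<beta>)\<close> the index \<open>m\<close> is a hit iff the point with coordinates
  \<open>m \<alpha> + \<gamma>\<^sub>m\<close> and \<open>m \<beta> + \<delta>\<^sub>m\<close>, which is uniform on the torus, lies in the hyperbolic region
  \<open>\<parallel>x\<parallel> \<parallel>y\<parallel> \<le> \<psi> m\<close>. This region has area at least \<open>4 \<psi> ln (1 / (4 \<psi>))\<close>, so by independence the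
  indices \<open>N, \<dots>, n\<close> are all missed with probability at most \<open>exp\<close> of minus the sum of these areas.
  To treat all \<open>(\<alpha>, \<beta>)\<close> at once, take the union bound over a grid of mesh
  \<open>n powr (- 2 - \<epsilon>/2)\<close>, which has about \<open>n powr (4 + \<epsilon>)\<close> points. Moving to a grid point perturbs the
  product of distances by at most \<open>\<kappa> = n powr (- 1 - \<epsilon>/2)\<close>. Replacing \<open>\<psi> m\<close> by \<open>\<psi> m - \<kappa>\<close> costs
  \<open>O(\<kappa> ln (1/\<kappa>))\<close> per index, which sums to \<open>O(1)\<close>. Hence the probability that some \<open>(\<alpha>, \<beta>)\<close> has
  no hit in \<open>{N..n}\<close> tends to zero along a subsequence of \<open>n\<close>. If \<open>\<psi>\<close> does not become small, it
  is bounded below by a constant, to which the argument applies with \<open>\<epsilon> = 1\<close>.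
\<close>

section \<open>Distance to the nearest integer\<close>

definition int_dist :: "real \<Rightarrow> real" where
  "int_dist x = \<bar>x - of_int (round x)\<bar>"

lemma int_dist_nonneg: "int_dist x \<ge> 0"
  by (simp add: int_dist_def)

lemma int_dist_le_half: "int_dist x \<le> 1 / 2"
  using of_int_round_abs_le[of x] by (simp add: int_dist_def abs_minus_commute)

lemma int_dist_minimal: "int_dist x \<le> \<bar>x - of_int k\<bar>"
  using round_diff_minimal[of x k] by (simp add: int_dist_def)

lemma int_dist_lipschitz: "int_dist x \<le> int_dist y + \<bar>x - y\<bar>"
  using int_dist_minimal[of x "round y"] by (simp add: int_dist_def)

lemma int_dist_add_int: "int_dist (x + of_int k) = int_dist x"
proof (rule antisym)
  show "int_dist (x + of_int k) \<le> int_dist x"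
    using int_dist_minimal[of "x + of_int k" "round x + k"] by (simp add: int_dist_def)
  show "int_dist x \<le> int_dist (x + of_int k)"
    using int_dist_minimal[of x "round (x + of_int k) - k"] by (simp add: int_dist_def algebra_simps)
qed

lemma int_dist_le_min_frac: "int_dist x \<le> min (frac x) (1 - frac x)"
  using int_dist_minimal[of x "\<lfloor>x\<rfloor>"] int_dist_minimal[of x "\<lfloor>x\<rfloor> + 1"] frac_lt_1[of x]
  by (simp add: frac_def)

lemma int_dist_measurable [measurable]: "int_dist \<in> borel_measurable borel"
  unfolding int_dist_def round_def by measurable

text \<open>Write \<open>a * b - c * d\<close> as \<open>a * (b - d) + (a - c) * d\<close>: each
  summand is at most \<open>k / 2\<close> because \<open>a\<close> and \<open>d\<close> are at most
  1/2. For distances to integers, a shift of both factors by \<open>k\<close> therefore costs only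
  \<open>k\<close> in the product.\<close>

lemma mult_diff_le:
  fixes a b c d k :: real
  assumes "0 \<le> a" "0 \<le> b" "0 \<le> c" "0 \<le> d" "a \<le> c + k" "b \<le> d + k" "a \<le> 1/2" "d \<le> 1/2" "0 \<le> k"
  shows "a * b \<le> c * d + k"
proof -
  have "a * b \<le> a * (d + k)" using assms by (intro mult_left_mono) auto
  also have "a * k \<le> 1/2 * k" using assms by (intro mult_right_mono) auto
  hence "a * (d + k) \<le> a * d + k/2" by (simp add: algebra_simps)
  also have "a * d \<le> (c + k) * d" using assms by (intro mult_right_mono) auto
  also have "k * d \<le> k * (1/2)" using assms by (intro mult_left_mono) auto
  hence "(c + k) * d \<le> c * d + k/2" by (simp add: algebra_simps)
  finally show ?thesis by simp
qed

section \<open>The uniform law on [0,1) and the area of the hyperbolic region\<close>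

abbreviation (input) unif :: "real measure" where
  "unif \<equiv> uniform_measure lborel {0..<1}"

lemma prob_space_unif: "prob_space unif"
  by (rule prob_space_uniform_measure) auto

lemma emeasure_unif: "A \<in> sets borel \<Longrightarrow> emeasure unif A = emeasure lborel ({0..<1} \<inter> A)"
  by (simp add: emeasure_uniform_measure divide_ennreal_def)

lemma emeasure_lborel_translate:
  fixes c :: real
  assumes "A \<in> sets borel"
  shows "emeasure lborel ((\<lambda>x. c + x) -` A) = emeasure lborel A"
proof -
  have "emeasure lborel A = emeasure (distr lborel borel ((+) c)) A"
    by (simp add: lborel_distr_plus)
  also have "\<dots> = emeasure lborel ((\<lambda>x. c + x) -` A)"
    using assms by (subst emeasure_distr) auto
  finally show ?thesis by simp
qed

text \<open>Rotation invariance of Lebesgue measure on the circle. It makes the hit probabilities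
  the same for every (\<alpha>, \<beta>).\<close>

lemma distr_frac_unif: "distr unif borel (\<lambda>x. frac (u + x)) = unif"
proof (rule measure_eqI)
  fix A assume "A \<in> sets (distr unif borel (\<lambda>x. frac (u + x)))"
  hence A [measurable]: "A \<in> sets borel" by simp
  define v where "v = frac u"
  have v: "0 \<le> v" "v < 1" by (auto simp: v_def frac_lt_1)
  have fr: "frac (u + x) = (if v + x < 1 then v + x else v - 1 + x)" if "0 \<le> x" "x < 1" for x
  proof -
    have "frac x = x" using that by (simp add: frac_eq)
    thus ?thesis by (simp add: frac_add v_def)
  qed
  \<comment> \<open>The rotation by \<open>v\<close> moves points with \<open>v + x < 1\<close> into
    [v,1) and wraps the others around to [0,v), so the preimage is a disjoint union of two
    translates.\<close>
  have eq: "{0..<1} \<inter> (\<lambda>x. frac (u + x)) -` A =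
      (\<lambda>x. v + x) -` (A \<inter> {v..<1}) \<union> (\<lambda>x. (v - 1) + x) -` (A \<inter> {0..<v})"
    using v fr by (auto split: if_splits)
  have ms: "(\<lambda>x. frac (u + x)) \<in> borel_measurable borel"
    unfolding frac_def by measurable
  have B: "(\<lambda>x. frac (u + x)) -` A \<in> sets borel"
    using measurable_sets[OF ms A] by simp
  have mt: "(\<lambda>x. c + x) -` D \<in> sets borel" if "D \<in> sets borel" for c :: real and D
    using measurable_sets[of "(\<lambda>x. c + x)" borel borel D] that by simp
  have "emeasure (distr unif borel (\<lambda>x. frac (u + x))) A = emeasure unif ((\<lambda>x. frac (u + x)) -` A)"
    using ms by (subst emeasure_distr) auto
  also have "\<dots> = emeasure lborel ({0..<1} \<inter> (\<lambda>x. frac (u + x)) -` A)"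
    by (rule emeasure_unif[OF B])
  also have "\<dots> = emeasure lborel ((\<lambda>x. v + x) -` (A \<inter> {v..<1})) +
      emeasure lborel ((\<lambda>x. (v - 1) + x) -` (A \<inter> {0..<v}))"
    unfolding eq by (rule plus_emeasure[symmetric]) (auto intro!: mt)
  also have "\<dots> = emeasure lborel (A \<inter> {v..<1}) + emeasure lborel (A \<inter> {0..<v})"
    by (subst (1 2) emeasure_lborel_translate) auto
  also have "\<dots> = emeasure lborel ((A \<inter> {v..<1}) \<union> (A \<inter> {0..<v}))"
    by (rule plus_emeasure) auto
  also have "(A \<inter> {v..<1}) \<union> (A \<inter> {0..<v}) = {0..<1} \<inter> A" using v by auto
  also have "emeasure lborel \<dots> = emeasure unif A" by (rule emeasure_unif[OF A, symmetric])
  finally show "emeasure (distr unif borel (\<lambda>x. frac (u + x))) A = emeasure unif A" .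
qed simp

text \<open>Here \<open>w\<close> stands for the distance of the first coordinate to the nearest
  integer. The section contains an interval of length \<open>t / w\<close> at each end of [0,1), and
  \<open>2 * t \<le> w\<close> keeps the two disjoint.\<close>

lemma emeasure_hyperbola_section:
  fixes w t :: real
  assumes "0 < w" "2 * t \<le> w" "0 \<le> t"
  shows "emeasure unif {y. w * min y (1 - y) \<le> t} \<ge> ennreal (2 * t / w)"
proof -
  define s where "s = t / w"
  have s: "0 \<le> s" "s \<le> 1/2" "w * s = t" using assms by (auto simp: s_def field_simps)
  have "ennreal (2 * t / w) = ennreal s + ennreal s"
    using s by (simp add: s_def flip: ennreal_plus)
  also have "\<dots> = emeasure lborel ({0..<s}) + emeasure lborel ({1-s..<1})" using s by simp
  also have "\<dots> = emeasure lborel ({0..<s} \<union> {1-s..<1})"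
    using s by (intro plus_emeasure) auto
  also have "\<dots> \<le> emeasure lborel ({0..<1} \<inter> {y. w * min y (1 - y) \<le> t})"
  proof (rule emeasure_mono)
    have "w * min y (1 - y) \<le> t" if "min y (1 - y) \<le> s" for y
      using mult_left_mono[OF that, of w] assms s by simp
    moreover have "min y (1 - y) \<le> s" if "y \<in> {0..<s} \<union> {1-s..<1}" for y
      using that by auto
    moreover have "{0..<s} \<union> {1-s..<1} \<subseteq> {0..<1}" using s by auto
    ultimately show "{0..<s} \<union> {1-s..<1} \<subseteq> {0..<1} \<inter> {y. w * min y (1 - y) \<le> t}"
      by blast
  qed measurable
  also have "\<dots> = emeasure unif {y. w * min y (1 - y) \<le> t}"
    by (rule emeasure_unif[symmetric]) measurable
  finally show ?thesis .
qed

lemma hyperbola_sets: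
  fixes t :: real
  shows "{(x, y). min x (1 - x) * min y (1 - y) \<le> t} \<in> sets (borel \<Otimes>\<^sub>M borel)"
proof -
  have "{p \<in> space (borel \<Otimes>\<^sub>M borel). min (fst p) (1 - fst p) * min (snd p) (1 - snd p) \<le> t}
      \<in> sets (borel \<Otimes>\<^sub>M borel)" by measurable
  thus ?thesis by (simp add: space_pair_measure case_prod_beta')
qed

text \<open>Fubini: the section bounds \<open>2 * t / x\<close> on [2t, 1/2] and
  \<open>2 * t / (1 - x)\<close> on its mirror image each integrate to
  \<open>2 * t * ln (1 / (4 * t))\<close>. The outer strips, where the section is everything, are
  dropped; they would add a further \<open>4 * t\<close>.\<close>

lemma emeasure_hyperbola:
  fixes t :: real
  assumes "0 < t" "t \<le> 1/4"
  shows "emeasure (unif \<Otimes>\<^sub>M unif) {(x, y). min x (1 - x) * min y (1 - y) \<le> t}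
           \<ge> ennreal (4 * t * ln (1 / (4 * t)))"
proof -
  interpret U: prob_space unif by (rule prob_space_unif)
  let ?H = "{(x, y). min x (1 - x) * min y (1 - y) \<le> t}"
  let ?f = "\<lambda>x. emeasure unif (Pair x -` ?H)"
  let ?a = "\<lambda>x. ennreal (2 * t / x) * indicator {2*t..1/2} x"
  \<comment> \<open>\<open>?b\<close> is open at 1/2 so that its support is disjoint from that of
    \<open>?a\<close>. The closed variant \<open>?b'\<close> differs from it on a null set and fits
    the fundamental theorem of calculus.\<close>
  let ?b = "\<lambda>x. ennreal (2 * t / (1 - x)) * indicator {1/2<..1-2*t} x"
  let ?b' = "\<lambda>x. ennreal (2 * t / (1 - x)) * indicator {1/2..1-2*t} x"
  have H: "?H \<in> sets (unif \<Otimes>\<^sub>M unif)"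
  proof -
    have "?H \<in> sets (borel \<Otimes>\<^sub>M borel)" by (rule hyperbola_sets)
    thus ?thesis by (simp cong: sets_pair_measure_cong)
  qed
  have Ia: "(\<integral>\<^sup>+x. ?a x \<partial>lborel) = ennreal (2 * t * ln (1 / (4 * t)))"
  proof -
    have "(\<integral>\<^sup>+x. ?a x \<partial>lborel) = ennreal (2 * t * ln (1/2) - 2 * t * ln (2 * t))"
      using assms by (intro nn_integral_FTC_Icc) (auto intro!: derivative_eq_intros simp: field_simps)
    also have "2 * t * ln (1/2) - 2 * t * ln (2 * t) = 2 * t * (ln (1/2) - ln (2 * t))"
      by (simp add: algebra_simps)
    also have "ln (1/2) - ln (2 * t) = ln (1 / (4 * t))"
      using assms by (simp flip: ln_divide_pos)
    finally show ?thesis .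
  qed
  have Ib: "(\<integral>\<^sup>+x. ?b x \<partial>lborel) = ennreal (2 * t * ln (1 / (4 * t)))"
  proof -
    have "(\<integral>\<^sup>+x. ?b x \<partial>lborel) = (\<integral>\<^sup>+x. ?b' x \<partial>lborel)"
      by (rule nn_integral_cong_AE, rule AE_mp[OF AE_lborel_singleton[of "1/2"]])
         (auto simp: indicator_def)
    also have "\<dots> = ennreal ((- 2 * t * ln (1 - (1 - 2 * t))) - (- 2 * t * ln (1 - 1/2)))"
      using assms by (intro nn_integral_FTC_Icc) (auto intro!: derivative_eq_intros simp: field_simps)
    also have "(- 2 * t * ln (1 - (1 - 2 * t))) - (- 2 * t * ln (1 - 1/2)) = 2 * t * (ln (1/2) - ln (2 * t))"
      by (simp add: algebra_simps)
    also have "ln (1/2) - ln (2 * t) = ln (1 / (4 * t))"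
      using assms by (simp flip: ln_divide_pos)
    finally show ?thesis .
  qed
  have le: "?a x + ?b x \<le> ?f x * indicator {0..<1} x" for x
  proof -
    have f: "?f x = emeasure unif {y. min x (1 - x) * min y (1 - y) \<le> t}"
      by (simp add: vimage_def)
    consider "x \<in> {2*t..1/2}" | "x \<in> {1/2<..1-2*t}" | "x \<notin> {2*t..1/2}" "x \<notin> {1/2<..1-2*t}" by blast
    thus ?thesis
    proof cases
      case 1
      hence "min x (1 - x) = x" by auto
      with 1 assms emeasure_hyperbola_section[of x t] show ?thesis unfolding f by auto
    next
      case 2
      hence "min x (1 - x) = 1 - x" by auto
      with 2 assms emeasure_hyperbola_section[of "1 - x" t] show ?thesis unfolding f by auto
    qed auto
  qed
  have l0: "ln (1 / (4 * t)) \<ge> 0" using assms by simp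
  have "ennreal (4 * t * ln (1 / (4 * t))) =
      ennreal (2 * t * ln (1 / (4 * t))) + ennreal (2 * t * ln (1 / (4 * t)))"
    using assms l0 by (subst ennreal_plus[symmetric]) (auto intro!: mult_nonneg_nonneg)
  also have "\<dots> = (\<integral>\<^sup>+x. ?a x + ?b x \<partial>lborel)"
    by (subst nn_integral_add) (simp_all add: Ia Ib)
  also have "\<dots> \<le> (\<integral>\<^sup>+x. ?f x * indicator {0..<1} x \<partial>lborel)"
    by (intro nn_integral_mono le)
  also have "\<dots> = (\<integral>\<^sup>+x. ?f x \<partial>unif)"
  proof -
    have "?f \<in> borel_measurable unif" using H by (rule U.measurable_emeasure_Pair)
    thus ?thesis by (subst nn_integral_uniform_measure) (auto simp: divide_ennreal_def)
  qed
  also have "\<dots> = emeasure (unif \<Otimes>\<^sub>M unif) ?H"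
    by (rule U.emeasure_pair_measure_alt[OF H, symmetric])
  finally show ?thesis .
qed


section \<open>Random shifts: probabilities of hits and misses for a fixed (\<alpha>,
  \<beta>)\<close>

text \<open>Joining both families by \<open>case_sum\<close> over a disjoint sum of index sets
  expresses the mutual independence of all the shifts as one statement.\<close>

locale uniform_shifts = prob_space M for M :: "'a measure" +
  fixes \<gamma> \<delta> :: "nat \<Rightarrow> 'a \<Rightarrow> real"
  assumes indep: "indep_vars (\<lambda>_. borel) (case_sum \<gamma> \<delta>) ({1..} <+> {1..})"
    and distr_\<gamma>: "\<And>n. n \<ge> 1 \<Longrightarrow> distr M borel (\<gamma> n) = unif"
    and distr_\<delta>: "\<And>n. n \<ge> 1 \<Longrightarrow> distr M borel (\<delta> n) = unif"
begin

text \<open>For \<open>m \<ge> 1\<close> this is \<open>m^2\<close> times the minimum over the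
  integers \<open>a\<close> and \<open>b\<close> of the product in the theorem. A hit at
  \<open>m\<close> means that it is at most \<open>\<psi> m\<close>.\<close>

definition dist_prod :: "real \<Rightarrow> real \<Rightarrow> nat \<Rightarrow> 'a \<Rightarrow> real" where
  "dist_prod \<alpha> \<beta> m \<omega> = int_dist (real m * \<alpha> + \<gamma> m \<omega>) * int_dist (real m * \<beta> + \<delta> m \<omega>)"

lemma random_variable_shift:
  assumes "m \<ge> 1"
  shows "\<gamma> m \<in> borel_measurable M" "\<delta> m \<in> borel_measurable M"
proof -
  have "case_sum \<gamma> \<delta> i \<in> borel_measurable M" if "i \<in> {1..} <+> {1..}" for i
    using indep that by (auto simp: indep_vars_def)
  from this[of "Inl m"] this[of "Inr m"] assms
  show "\<gamma> m \<in> borel_measurable M" "\<delta> m \<in> borel_measurable M" by auto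
qed

text \<open>The variable with index \<open>m\<close> depends only on the block
  \<open>{Inl m, Inr m}\<close>, and functions of disjoint blocks of an independent family are
  independent.\<close>

lemma indep_vars_dist_prod:
  "indep_vars (\<lambda>_. borel) (dist_prod \<alpha> \<beta>) {1..}"
proof -
  let ?K = "\<lambda>m::nat. {Inl m, Inr m}"
  let ?Y = "\<lambda>m f. int_dist (real m * \<alpha> + f (Inl m)) * int_dist (real m * \<beta> + f (Inr m))"
  have "indep_vars (\<lambda>m. PiM (?K m) (\<lambda>_. borel :: real measure))
      (\<lambda>m \<omega>. restrict (\<lambda>i. case_sum \<gamma> \<delta> i \<omega>) (?K m)) {1..}"
    by (rule indep_vars_restrict[OF indep]) (auto simp: disjoint_family_on_def)
  hence "indep_vars (\<lambda>_. borel) (\<lambda>m \<omega>. ?Y m (restrict (\<lambda>i. case_sum \<gamma> \<delta> i \<omega>) (?K m))) {1..}"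
  proof (rule indep_vars_compose2)
    fix m :: nat
    have [measurable]: "(\<lambda>f. f (Inl m)) \<in> borel_measurable (PiM (?K m) (\<lambda>_. borel :: real measure))"
      "(\<lambda>f. f (Inr m)) \<in> borel_measurable (PiM (?K m) (\<lambda>_. borel :: real measure))"
      by (rule measurable_component_singleton, simp)+
    show "?Y m \<in> borel_measurable (PiM (?K m) (\<lambda>_. borel :: real measure))" by measurable
  qed
  thus ?thesis by (simp add: dist_prod_def[abs_def])
qed

text \<open>Both coordinates are rotations of independent uniform variables, so each stays uniform
  and the joint law is the product.\<close>

lemma distr_shift_pair:
  assumes "m \<ge> 1"
  shows "distr M (borel \<Otimes>\<^sub>M borel) (\<lambda>\<omega>. (frac (u + \<gamma> m \<omega>), frac (v + \<delta> m \<omega>))) = unif \<Otimes>\<^sub>M unif"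
proof -
  let ?A = "{Inl m :: nat + nat}" and ?B = "{Inr m :: nat + nat}"
  have fr: "(\<lambda>x. frac (w + x)) \<in> borel_measurable borel" for w :: real
    unfolding frac_def by measurable
  have "indep_var (PiM ?A (\<lambda>_. borel :: real measure)) (\<lambda>\<omega>. restrict (\<lambda>i. case_sum \<gamma> \<delta> i \<omega>) ?A)
     (PiM ?B (\<lambda>_. borel :: real measure)) (\<lambda>\<omega>. restrict (\<lambda>i. case_sum \<gamma> \<delta> i \<omega>) ?B)"
    using assms by (intro indep_var_restrict[OF indep]) auto
  hence "indep_var borel ((\<lambda>f. frac (u + f (Inl m))) \<circ> (\<lambda>\<omega>. restrict (\<lambda>i. case_sum \<gamma> \<delta> i \<omega>) ?A))
    borel ((\<lambda>f. frac (v + f (Inr m))) \<circ> (\<lambda>\<omega>. restrict (\<lambda>i. case_sum \<gamma> \<delta> i \<omega>) ?B))"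
    by (rule indep_var_compose)
       (auto intro!: measurable_compose[OF _ fr] measurable_component_singleton)
  hence "indep_var borel (\<lambda>\<omega>. frac (u + \<gamma> m \<omega>)) borel (\<lambda>\<omega>. frac (v + \<delta> m \<omega>))"
    by (simp add: comp_def)
  moreover have "distr M borel (\<lambda>\<omega>. frac (u + \<gamma> m \<omega>)) = unif"
    using distr_distr[OF fr random_variable_shift(1)[OF assms], of u] distr_\<gamma>[OF assms] distr_frac_unif[of u]
    by (simp add: comp_def)
  moreover have "distr M borel (\<lambda>\<omega>. frac (v + \<delta> m \<omega>)) = unif"
    using distr_distr[OF fr random_variable_shift(2)[OF assms], of v] distr_\<delta>[OF assms] distr_frac_unif[of v]
    by (simp add: comp_def)
  ultimately show ?thesis by (simp add: indep_var_distribution_eq)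
qed

lemma dist_prod_measurable [measurable]:
  "m \<ge> 1 \<Longrightarrow> dist_prod \<alpha> \<beta> m \<in> borel_measurable M"
  using indep_vars_dist_prod[of \<alpha> \<beta>] by (auto simp: indep_vars_def)

text \<open>The pair of fractional parts is uniform on the unit square, and whenever it falls into
  the hyperbolic region there is a hit, so the area bound carries over. For \<open>t = 0\<close> the
  lower bound is 0.\<close>

lemma prob_hit_ge:
  assumes "m \<ge> 1" "0 \<le> t" "t \<le> 1/4"
  shows "prob {\<omega> \<in> space M. dist_prod \<alpha> \<beta> m \<omega> \<le> t} \<ge> 4 * t * ln (1 / (4 * t))"
proof (cases "t = 0")
  case False
  with assms have t: "0 < t" "t \<le> 1/4" by auto
  note [measurable] = random_variable_shift[OF assms(1)] dist_prod_measurable[OF assms(1)]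
  let ?H = "{(x, y). min x (1 - x) * min y (1 - y) \<le> t}"
  let ?f = "\<lambda>\<omega>. (frac (real m * \<alpha> + \<gamma> m \<omega>), frac (real m * \<beta> + \<delta> m \<omega>))"
  have f: "?f \<in> measurable M (borel \<Otimes>\<^sub>M borel)"
    unfolding frac_def by measurable
  have H: "?H \<in> sets (borel \<Otimes>\<^sub>M borel)" by (rule hyperbola_sets)
  have "ennreal (4 * t * ln (1 / (4 * t))) \<le> emeasure (unif \<Otimes>\<^sub>M unif) ?H"
    by (rule emeasure_hyperbola[OF t])
  also have "\<dots> = emeasure (distr M (borel \<Otimes>\<^sub>M borel) ?f) ?H"
    by (simp only: distr_shift_pair[OF assms(1)])
  also have "\<dots> = emeasure M (?f -` ?H \<inter> space M)"
    by (rule emeasure_distr[OF f H])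
  also have "\<dots> \<le> emeasure M {\<omega> \<in> space M. dist_prod \<alpha> \<beta> m \<omega> \<le> t}"
  proof (rule emeasure_mono)
    have "dist_prod \<alpha> \<beta> m \<omega> \<le> min (fst (?f \<omega>)) (1 - fst (?f \<omega>)) * min (snd (?f \<omega>)) (1 - snd (?f \<omega>))" for \<omega>
      unfolding dist_prod_def fst_conv snd_conv
      by (intro mult_mono int_dist_le_min_frac int_dist_nonneg order_trans[OF int_dist_nonneg int_dist_le_min_frac])
    thus "?f -` ?H \<inter> space M \<subseteq> {\<omega> \<in> space M. dist_prod \<alpha> \<beta> m \<omega> \<le> t}"
      by (auto intro: order_trans)
  qed measurable
  finally show ?thesis
    by (simp add: emeasure_eq_measure)
qed simp

text \<open>By independence the miss probabilities multiply, and each is at most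
  \<open>1 - p \<le> exp (- p)\<close>, where \<open>p\<close> is the area bound for that
  index.\<close>

lemma prob_miss_le:
  assumes "finite I" "I \<subseteq> {1..}" "\<And>m. m \<in> I \<Longrightarrow> 0 \<le> t m \<and> t m \<le> 1/4"
  shows "{\<omega> \<in> space M. \<forall>m\<in>I. t m < dist_prod \<alpha> \<beta> m \<omega>} \<in> events"
    and "prob {\<omega> \<in> space M. \<forall>m\<in>I. t m < dist_prod \<alpha> \<beta> m \<omega>}
           \<le> exp (- (\<Sum>m\<in>I. 4 * t m * ln (1 / (4 * t m))))"
proof -
  note [measurable] = dist_prod_measurable
  have ge1: "m \<ge> 1" if "m \<in> I" for m using that assms(2) by auto
  show ev: "{\<omega> \<in> space M. \<forall>m\<in>I. t m < dist_prod \<alpha> \<beta> m \<omega>} \<in> events"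
    using assms(1) ge1 by measurable
  show "prob {\<omega> \<in> space M. \<forall>m\<in>I. t m < dist_prod \<alpha> \<beta> m \<omega>}
           \<le> exp (- (\<Sum>m\<in>I. 4 * t m * ln (1 / (4 * t m))))"
  \<comment> \<open>The product rule and the rewriting as an intersection require a nonempty index
    set; for the empty one the bound is \<open>exp 0 = 1\<close>.\<close>
  proof (cases "I = {}")
    case False
    let ?X = "dist_prod \<alpha> \<beta>"
    have one: "prob (?X m -` {t m<..} \<inter> space M) \<le> exp (- (4 * t m * ln (1 / (4 * t m))))" if "m \<in> I" for m
    proof -
      have E: "{\<omega> \<in> space M. ?X m \<omega> \<le> t m} \<in> events" using ge1[OF that] by measurable
      have "?X m -` {t m<..} \<inter> space M = space M - {\<omega> \<in> space M. ?X m \<omega> \<le> t m}" by auto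
      hence "prob (?X m -` {t m<..} \<inter> space M) = 1 - prob {\<omega> \<in> space M. ?X m \<omega> \<le> t m}"
        using prob_compl[OF E] by simp
      also have "\<dots> \<le> 1 + (- (4 * t m * ln (1 / (4 * t m))))"
        using prob_hit_ge[OF ge1[OF that], of "t m" \<alpha> \<beta>] assms(3)[OF that] by simp
      also have "\<dots> \<le> exp (- (4 * t m * ln (1 / (4 * t m))))" by (rule exp_ge_add_one_self)
      finally show ?thesis .
    qed
    have "{\<omega> \<in> space M. \<forall>m\<in>I. t m < ?X m \<omega>} = (\<Inter>m\<in>I. ?X m -` {t m<..} \<inter> space M)"
      using False by auto
    also have "prob \<dots> = (\<Prod>m\<in>I. prob (?X m -` {t m<..} \<inter> space M))"
      using assms(1) False
      by (intro indep_varsD_finite[OF indep_vars_subset[OF indep_vars_dist_prod assms(2)]]) auto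
    also have "\<dots> \<le> (\<Prod>m\<in>I. exp (- (4 * t m * ln (1 / (4 * t m)))))"
      by (intro prod_mono) (auto intro: one)
    also have "\<dots> = exp (- (\<Sum>m\<in>I. 4 * t m * ln (1 / (4 * t m))))"
      using assms(1) by (simp add: exp_sum sum_negf[symmetric])
    finally show ?thesis .
  qed simp
qed

end

section \<open>Discretising (\<alpha>, \<beta>) and the union bound\<close>

text \<open>Round \<open>frac \<alpha>\<close> down to a multiple of \<open>1 / K\<close>; the
  integer part of \<alpha> changes \<open>m * \<alpha>\<close> by an integer only. The error below
  \<open>1 / K\<close> is multiplied by \<open>m \<le> n\<close>. One \<open>i\<close> serves all
  \<open>m\<close> and all shifts \<open>x\<close> at once.\<close>

lemma grid_approx:
  fixes \<alpha> \<kappa> :: real and K n :: nat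
  assumes "K \<ge> 1" "real n / real K \<le> \<kappa>"
  obtains i where "i < K"
    "\<And>m x. m \<le> n \<Longrightarrow> int_dist (real m * \<alpha> + x) \<le> int_dist (real m * (real i / real K) + x) + \<kappa>"
proof -
  define i where "i = nat \<lfloor>real K * frac \<alpha>\<rfloor>"
  have i: "real i \<le> real K * frac \<alpha>" "real K * frac \<alpha> < real i + 1"
    using frac_ge_0[of \<alpha>] by (auto simp: i_def of_nat_nat)
  have "real K * frac \<alpha> < real K * 1" using assms(1) by (intro mult_strict_left_mono) (auto simp: frac_lt_1)
  with i(1) have iK: "i < K" by simp
  have d: "\<bar>frac \<alpha> - real i / real K\<bar> \<le> 1 / real K"
  proof -
    have "\<bar>real K * (frac \<alpha> - real i / real K)\<bar> \<le> 1"
      using i assms(1) by (simp add: right_diff_distrib)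
    hence "\<bar>frac \<alpha> - real i / real K\<bar> * real K \<le> 1" by (simp add: abs_mult mult.commute)
    thus ?thesis using assms(1) by (subst pos_le_divide_eq) auto
  qed
  show thesis
  proof (rule that[OF iK])
    fix m x assume m: "m \<le> n"
    have "real m * \<alpha> + x = (real m * frac \<alpha> + x) + of_int (int m * \<lfloor>\<alpha>\<rfloor>)"
      by (simp add: frac_def algebra_simps)
    hence "int_dist (real m * \<alpha> + x) = int_dist (real m * frac \<alpha> + x)"
      by (simp only: int_dist_add_int)
    also have "\<dots> \<le> int_dist (real m * (real i / real K) + x) + \<bar>real m * frac \<alpha> + x - (real m * (real i / real K) + x)\<bar>"
      by (rule int_dist_lipschitz)
    also have "\<bar>real m * frac \<alpha> + x - (real m * (real i / real K) + x)\<bar> = real m * \<bar>frac \<alpha> - real i / real K\<bar>"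
    proof -
      have "real m * frac \<alpha> + x - (real m * (real i / real K) + x) = real m * (frac \<alpha> - real i / real K)"
        by (simp add: algebra_simps)
      thus ?thesis by (simp add: abs_mult)
    qed
    also have "\<dots> \<le> real n * (1 / real K)" using m d by (intro mult_mono) auto
    finally show "int_dist (real m * \<alpha> + x) \<le> int_dist (real m * (real i / real K) + x) + \<kappa>"
      using assms(2) by simp
  qed
qed

context uniform_shifts
begin

text \<open>A union bound over the \<open>K * K\<close> grid points. Since the bad set is an
  uncountable union over (\<alpha>, \<beta>), its measurability is sidestepped by covering it with
  an event \<open>A\<close>.\<close>

lemma uniform_miss_bound:
  fixes n N :: nat and \<psi> :: "nat \<Rightarrow> real"
  assumes "1 \<le> N" "1 \<le> n" "\<epsilon> > 0" "\<And>m. m \<ge> N \<Longrightarrow> \<psi> m \<le> 1/4"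
  defines "\<kappa> \<equiv> real n powr (- 1 - \<epsilon>/2)"
  shows "\<exists>A\<in>events. {\<omega>\<in>space M. \<exists>\<alpha> \<beta>. \<forall>m\<in>{N..n}. \<psi> m < dist_prod \<alpha> \<beta> m \<omega>} \<subseteq> A \<and>
    prob A \<le> 4 * real n powr (4 + \<epsilon>) *
      exp (- (\<Sum>m=N..n. 4 * max 0 (\<psi> m - \<kappa>) * ln (1 / (4 * max 0 (\<psi> m - \<kappa>)))))"
proof -
  \<comment> \<open>This size balances two demands: \<open>n / K \<le> \<kappa>\<close>, and at most
    \<open>4 * n powr (4 + \<epsilon>)\<close> grid points.\<close>
  define K where "K = nat \<lceil>real n powr (2 + \<epsilon>/2)\<rceil>"
  define t where "t = (\<lambda>m. max 0 (\<psi> m - \<kappa>))"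
  \<comment> \<open>Where \<open>\<psi> m \<le> \<kappa>\<close>, a miss at (\<alpha>, \<beta>) says
    nothing about the grid point. Such indices are left out; they have \<open>t m = 0\<close> and
    contribute nothing to \<open>S\<close>.\<close>
  define I where "I = {m\<in>{N..n}. \<psi> m > \<kappa>}"
  define S where "S = (\<Sum>m=N..n. 4 * t m * ln (1 / (4 * t m)))"
  have np: "real n powr (2 + \<epsilon>/2) \<ge> 1" using assms by (intro ge_one_powr_ge_zero) auto
  have K: "real n powr (2 + \<epsilon>/2) \<le> real K" "real K \<le> 2 * real n powr (2 + \<epsilon>/2)" "K \<ge> 1"
    unfolding K_def using np by linarith+
  have "real n / real K \<le> real n / real n powr (2 + \<epsilon>/2)"
    using K np assms(2) by (intro divide_left_mono mult_pos_pos) auto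
  also have "\<dots> = \<kappa>"
  proof -
    have "\<kappa> = real n powr (1 - (2 + \<epsilon>/2))" unfolding \<kappa>_def by (rule arg_cong) simp
    also have "\<dots> = real n powr 1 / real n powr (2 + \<epsilon>/2)" by (rule powr_diff)
    finally show ?thesis using assms(2) by simp
  qed
  finally have nK: "real n / real K \<le> \<kappa>" .
  have \<kappa>0: "\<kappa> \<ge> 0" by (simp add: \<kappa>_def)
  have t: "0 \<le> t m \<and> t m \<le> 1/4" if "m \<in> I" for m
    using that assms(4)[of m] \<kappa>0 by (auto simp: t_def I_def)
  have I: "finite I" "I \<subseteq> {1..}" using assms(1) by (auto simp: I_def)
  define E where "E = (\<lambda>i j. {\<omega> \<in> space M. \<forall>m\<in>I. t m < dist_prod (real i / real K) (real j / real K) m \<omega>})"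
  define A where "A = (\<Union>(i, j)\<in>{..<K}\<times>{..<K}. E i j)"
  have Eev: "E i j \<in> events" for i j
    unfolding E_def by (rule prob_miss_le(1)[where t = t, OF I t])
  have "(\<Sum>m\<in>I. 4 * t m * ln (1 / (4 * t m))) = S"
    unfolding S_def by (rule sum.mono_neutral_left) (auto simp: I_def t_def)
  hence Epr: "prob (E i j) \<le> exp (- S)" for i j
    using prob_miss_le(2)[where t = t, OF I t, of "real i / real K" "real j / real K"]
    unfolding E_def by simp
  have "A \<in> events" unfolding A_def using Eev by (intro sets.finite_UN) auto
  moreover have "{\<omega>\<in>space M. \<exists>\<alpha> \<beta>. \<forall>m\<in>{N..n}. \<psi> m < dist_prod \<alpha> \<beta> m \<omega>} \<subseteq> A"
  proof safe
    fix \<omega> \<alpha> \<beta> assume \<omega>: "\<omega> \<in> space M" and bad: "\<forall>m\<in>{N..n}. \<psi> m < dist_prod \<alpha> \<beta> m \<omega>"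
    obtain i where i: "i < K"
      "\<And>m x. m \<le> n \<Longrightarrow> int_dist (real m * \<alpha> + x) \<le> int_dist (real m * (real i / real K) + x) + \<kappa>"
      using grid_approx[OF K(3) nK] by blast
    obtain j where j: "j < K"
      "\<And>m x. m \<le> n \<Longrightarrow> int_dist (real m * \<beta> + x) \<le> int_dist (real m * (real j / real K) + x) + \<kappa>"
      using grid_approx[OF K(3) nK] by blast
    have "t m < dist_prod (real i / real K) (real j / real K) m \<omega>" if "m \<in> I" for m
    proof -
      have m: "m \<in> {N..n}" "\<psi> m > \<kappa>" using that by (auto simp: I_def)
      have "dist_prod \<alpha> \<beta> m \<omega> \<le> dist_prod (real i / real K) (real j / real K) m \<omega> + \<kappa>"
        unfolding dist_prod_def using m i(2) j(2) \<kappa>0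
        by (intro mult_diff_le int_dist_nonneg int_dist_le_half) auto
      moreover have "\<psi> m < dist_prod \<alpha> \<beta> m \<omega>" using bad m by blast
      ultimately show ?thesis using m by (simp add: t_def)
    qed
    hence "\<omega> \<in> E i j" using \<omega> by (simp add: E_def)
    thus "\<omega> \<in> A" using i j by (auto simp: A_def)
  qed
  moreover have "prob A \<le> 4 * real n powr (4 + \<epsilon>) * exp (- S)"
  proof -
    have "prob A \<le> (\<Sum>p\<in>{..<K}\<times>{..<K}. prob (case p of (i, j) \<Rightarrow> E i j))"
      unfolding A_def using Eev by (intro finite_measure_subadditive_finite) auto
    also have "\<dots> \<le> (\<Sum>p\<in>{..<K}\<times>{..<K}. exp (- S))"
      by (intro sum_mono) (auto simp: Epr)
    also have "\<dots> = real K * real K * exp (- S)" by (simp add: card_cartesian_product)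
    also have "\<dots> \<le> (2 * real n powr (2 + \<epsilon>/2)) * (2 * real n powr (2 + \<epsilon>/2)) * exp (- S)"
      using K by (intro mult_right_mono mult_mono) auto
    also have "(2 * real n powr (2 + \<epsilon>/2)) * (2 * real n powr (2 + \<epsilon>/2)) = 4 * real n powr (4 + \<epsilon>)"
      by (simp flip: powr_add)
    finally show ?thesis .
  qed
  ultimately show ?thesis unfolding S_def t_def by blast
qed

end

section \<open>Cost of lowering the thresholds by \<kappa>\<close>

text \<open>For \<open>t > \<kappa>\<close>, the 4 inside the logarithm costs
  \<open>4 * t * ln 4\<close>, which the third assumption absorbs into
  \<open>\<epsilon> * t * ln (1/t)\<close>, and lowering the factor \<open>t\<close> costs at most
  \<open>4 * \<kappa> * ln (1/\<kappa>)\<close>. For \<open>t \<le> \<kappa>\<close> the left side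
  is 0 and the right side is not positive.\<close>

lemma hyperbola_term_bound:
  fixes t \<kappa> \<epsilon> :: real
  assumes "0 \<le> t" "t \<le> 1/4" "t > 0 \<Longrightarrow> \<epsilon> * ln (1/t) \<ge> 4 * ln 4" "0 < \<kappa>" "\<kappa> \<le> 1" "\<epsilon> > 0"
  shows "4 * max 0 (t - \<kappa>) * ln (1 / (4 * max 0 (t - \<kappa>)))
           \<ge> (4 - \<epsilon>) * (t * ln (1/t)) - 4 * (\<kappa> + \<kappa> * ln (1/\<kappa>))"
proof (cases "t > \<kappa>")
  case True
  hence t: "t > 0" using assms by simp
  have 1: "ln (1 / (4 * (t - \<kappa>))) \<ge> ln (1 / (4 * t))"
    using True t assms by (intro ln_mono) (auto simp: field_simps)
  have "4 * (t - \<kappa>) * ln (1 / (4 * (t - \<kappa>))) \<ge> 4 * (t - \<kappa>) * ln (1 / (4 * t))"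
    using True 1 by (intro mult_left_mono) auto
  moreover have "ln (1 / (4 * t)) \<le> ln (1 / \<kappa>)"
    using True t assms by (intro ln_mono) (auto simp: field_simps)
  hence "\<kappa> * ln (1 / (4 * t)) \<le> \<kappa> * ln (1 / \<kappa>)" using assms by (intro mult_left_mono) auto
  moreover have "4 * (t - \<kappa>) * ln (1 / (4 * t)) = 4 * (t * ln (1 / (4 * t))) - 4 * (\<kappa> * ln (1 / (4 * t)))"
    by (simp only: left_diff_distrib right_diff_distrib mult.assoc)
  moreover have "ln (1 / (4 * t)) = ln (1 / t) - ln 4" using t by (simp add: ln_div ln_mult)
  hence "t * ln (1 / (4 * t)) = t * ln (1 / t) - t * ln 4" by (simp only: right_diff_distrib)
  moreover have "t * (\<epsilon> * ln (1/t)) \<ge> t * (4 * ln 4)" using t assms by (intro mult_left_mono) auto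
  moreover have "(4 - \<epsilon>) * (t * ln (1/t)) = 4 * (t * ln (1/t)) - t * (\<epsilon> * ln (1/t))"
    by (simp add: algebra_simps)
  moreover have "max 0 (t - \<kappa>) = t - \<kappa>" using True by simp
  ultimately show ?thesis using assms(4) by (simp only:) argo
next
  case False
  show ?thesis
  proof (cases "t = 0")
    case True
    have "0 \<le> 4 * (\<kappa> + \<kappa> * ln (1/\<kappa>))"
      using assms by (intro mult_nonneg_nonneg add_nonneg_nonneg) auto
    moreover have "max 0 (t - \<kappa>) = 0" using True assms(4) by simp
    ultimately show ?thesis using True
      by (simp only: mult_zero_left mult_zero_right diff_0 neg_le_0_iff_le)
  next
    case t0: False
    hence t: "t > 0" "t \<le> \<kappa>" using assms False by auto
    have nn: "t * ln (1/t) \<ge> 0" using t assms by (intro mult_nonneg_nonneg) auto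
    \<comment> \<open>The map from \<open>t\<close> to \<open>t * ln (1/t)\<close> is not monotone
      up to 1, so comparison with \<kappa> goes through \<open>ln x \<le> x - 1\<close>; this
      produces the extra summand \<kappa>.\<close>
    have "ln (1/t) = ln (\<kappa> / t) + ln (1/\<kappa>)" using t assms by (simp add: ln_div)
    also have "ln (\<kappa>/t) \<le> \<kappa>/t - 1" using t assms by (intro ln_le_minus_one) auto
    finally have "t * ln (1/t) \<le> t * (\<kappa>/t - 1 + ln (1/\<kappa>))" using t by (intro mult_left_mono) auto
    also have "\<dots> = \<kappa> - t + t * ln (1/\<kappa>)" using t by (simp add: field_simps)
    also have "t * ln (1/\<kappa>) \<le> \<kappa> * ln (1/\<kappa>)" using t assms by (intro mult_right_mono) auto
    finally have "t * ln (1/t) \<le> \<kappa> + \<kappa> * ln (1/\<kappa>)" using t by simp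
    moreover have "(4 - \<epsilon>) * (t * ln (1/t)) \<le> 4 * (t * ln (1/t))"
      using nn assms by (intro mult_right_mono) auto
    ultimately have "(4 - \<epsilon>) * (t * ln (1/t)) - 4 * (\<kappa> + \<kappa> * ln (1/\<kappa>)) \<le> 0" by argo
    moreover have "max 0 (t - \<kappa>) = 0" using t by simp
    ultimately show ?thesis by (simp only: mult_zero_left mult_zero_right)
  qed
qed

text \<open>Here \<open>n * \<kappa> = n powr (- (\<epsilon>/2))\<close>, while
  \<open>ln (1/\<kappa>)\<close> is a multiple of \<open>ln n\<close> and hence at most a constant
  times \<open>n powr (\<epsilon>/2)\<close>. The powers cancel, so the total cost over
  \<open>n\<close> indices is bounded independently of \<open>n\<close>.\<close>

lemma perturbation_sum_bound:
  fixes n :: nat and \<epsilon> :: real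
  assumes "n \<ge> 1" "\<epsilon> > 0"
  defines "\<kappa> \<equiv> real n powr (- 1 - \<epsilon>/2)"
  shows "real n * (\<kappa> + \<kappa> * ln (1/\<kappa>)) \<le> 1 + (1 + \<epsilon>/2) / (\<epsilon>/2)"
proof -
  have n: "real n \<ge> 1" using assms by simp
  have "real n * \<kappa> = real n powr 1 * real n powr (- 1 - \<epsilon>/2)" using n unfolding \<kappa>_def by simp
  also have "\<dots> = real n powr (- (\<epsilon>/2))" unfolding powr_add[symmetric] by (rule arg_cong) simp
  finally have nk: "real n * \<kappa> = real n powr (- (\<epsilon>/2))" .
  have "ln \<kappa> = (- 1 - \<epsilon>/2) * ln (real n)" using n by (simp add: \<kappa>_def ln_powr)
  hence l: "ln (1/\<kappa>) = (1 + \<epsilon>/2) * ln (real n)" using n by (simp add: ln_div \<kappa>_def algebra_simps)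
  have "ln (real n) \<le> real n powr (\<epsilon>/2) / (\<epsilon>/2)" using n assms by (intro ln_powr_bound) auto
  hence "ln (1/\<kappa>) \<le> (1 + \<epsilon>/2) * (real n powr (\<epsilon>/2) / (\<epsilon>/2))"
    unfolding l using assms by (intro mult_left_mono) auto
  hence "real n powr (- (\<epsilon>/2)) * ln (1/\<kappa>) \<le> real n powr (- (\<epsilon>/2)) * ((1 + \<epsilon>/2) * (real n powr (\<epsilon>/2) / (\<epsilon>/2)))"
    by (intro mult_left_mono) auto
  also have "\<dots> = (real n powr (- (\<epsilon>/2)) * real n powr (\<epsilon>/2)) * ((1 + \<epsilon>/2) / (\<epsilon>/2))" by simp
  also have "real n powr (- (\<epsilon>/2)) * real n powr (\<epsilon>/2) = 1" using n by (simp flip: powr_add)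
  also have "1 * ((1 + \<epsilon>/2) / (\<epsilon>/2)) = (1 + \<epsilon>/2) / (\<epsilon>/2)" by simp
  finally have "real n powr (- (\<epsilon>/2)) * ln (1/\<kappa>) \<le> (1 + \<epsilon>/2) / (\<epsilon>/2)" .
  moreover have "real n powr (- (\<epsilon>/2)) \<le> real n powr 0" using n assms by (intro powr_mono) auto
  moreover have "real n * (\<kappa> + \<kappa> * ln (1/\<kappa>)) = real n * \<kappa> + (real n * \<kappa>) * ln (1/\<kappa>)" by (simp add: algebra_simps)
  ultimately show ?thesis using n unfolding nk by simp
qed

section \<open>Almost sure hits for all (\<alpha>, \<beta>) simultaneously\<close>

context uniform_shifts
begin

text \<open>The union bound at suitable \<open>n\<close> covers the set with no hit from
  \<open>N\<close> on by events of arbitrarily small probability. The bound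
  \<open>exp (- 4 * ln 4 / \<epsilon>)\<close> is what makes
  \<open>\<epsilon> * ln (1 / \<psi> m) \<ge> 4 * ln 4\<close>.\<close>

lemma AE_hits_of_eventually_small:
  fixes \<psi> :: "nat \<Rightarrow> real" and \<epsilon> :: real
  assumes \<epsilon>: "\<epsilon> > 0"
    and small: "\<And>m. m \<ge> N\<^sub>0 \<Longrightarrow> 0 \<le> \<psi> m \<and> \<psi> m \<le> 1/4 \<and> \<psi> m \<le> exp (- 4 * ln 4 / \<epsilon>)"
    and div: "\<And>B N. \<exists>n\<ge>N. B \<le> 1 / real n powr (4 + \<epsilon>) *
           exp ((4 - \<epsilon>) * (\<Sum>m = 1..n. \<psi> m * ln (1 / \<psi> m)))"
  shows "AE \<omega> in M. \<forall>\<alpha> \<beta>. \<forall>N. \<exists>n\<ge>N. n \<ge> 1 \<and> dist_prod \<alpha> \<beta> n \<omega> \<le> \<psi> n"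
proof -
  \<comment> \<open>A zero value of \<psi> gives the summand 0, matching the convention of the
    theorem.\<close>
  define f where "f = (\<lambda>m. \<psi> m * ln (1 / \<psi> m))"
  define bad where "bad = (\<lambda>N. {\<omega>\<in>space M. \<exists>\<alpha> \<beta>. \<forall>m\<ge>N. \<psi> m < dist_prod \<alpha> \<beta> m \<omega>})"
  have main: "\<exists>A\<in>null_sets M. bad N \<subseteq> A" if N: "N \<ge> 1" "N \<ge> N\<^sub>0" for N
  proof -
    \<comment> \<open>\<open>D\<close> bounds the total perturbation cost; \<open>C\<close> also
      accounts for the summands before \<open>N\<close>, which occur in the hypothesis but not in
      the miss bound.\<close>
    define D where "D = 4 * (1 + (1 + \<epsilon>/2) / (\<epsilon>/2))"
    define C where "C = D + (4 - \<epsilon>) * (\<Sum>m = 1..<N. f m)"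
    have "\<exists>A\<in>events. bad N \<subseteq> A \<and> prob A \<le> 1 / real (Suc k)" for k
    proof -
      \<comment> \<open>The factor \<open>4 * exp C\<close> cancels the constants of the union
        bound, leaving probability at most \<open>1 / Suc k\<close>.\<close>
      obtain n where n: "n \<ge> N" and B: "4 * exp C * real (Suc k) \<le> 1 / real n powr (4 + \<epsilon>) *
           exp ((4 - \<epsilon>) * (\<Sum>m = 1..n. f m))"
        using div[of N "4 * exp C * real (Suc k)"] unfolding f_def by blast
      define \<kappa> where "\<kappa> = real n powr (- 1 - \<epsilon>/2)"
      define q where "q = (\<lambda>m. 4 * max 0 (\<psi> m - \<kappa>) * ln (1 / (4 * max 0 (\<psi> m - \<kappa>))))"
      have n1: "n \<ge> 1" using n N by simp
      have \<kappa>: "0 < \<kappa>" using n1 by (simp add: \<kappa>_def)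
      have "\<kappa> \<le> real n powr 0" unfolding \<kappa>_def using n1 \<epsilon> by (intro powr_mono) auto
      hence \<kappa>1: "\<kappa> \<le> 1" using n1 by simp
      have "\<psi> m \<le> 1/4" if "m \<ge> N" for m using small[of m] that N by simp
      from uniform_miss_bound[where \<psi> = \<psi>, OF N(1) n1 \<epsilon> this] obtain A where A: "A \<in> events"
        "{\<omega>\<in>space M. \<exists>\<alpha> \<beta>. \<forall>m\<in>{N..n}. \<psi> m < dist_prod \<alpha> \<beta> m \<omega>} \<subseteq> A"
        "prob A \<le> 4 * real n powr (4 + \<epsilon>) * exp (- (\<Sum>m=N..n. q m))"
        unfolding q_def \<kappa>_def by blast
      define r where "r = 4 * (\<kappa> + \<kappa> * ln (1/\<kappa>))"
      have r0: "r \<ge> 0" unfolding r_def using \<kappa> \<kappa>1 by (auto intro!: add_nonneg_nonneg mult_nonneg_nonneg)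
      have "(4 - \<epsilon>) * f m - r \<le> q m" if "m \<ge> N" for m
        unfolding f_def q_def r_def
      proof (rule hyperbola_term_bound)
        show "0 \<le> \<psi> m" "\<psi> m \<le> 1/4" using small[of m] that N by auto
        assume p: "\<psi> m > 0"
        have "ln (\<psi> m) \<le> ln (exp (- 4 * ln 4 / \<epsilon>))" using small[of m] that N p by (subst ln_le_cancel_iff) auto
        hence "\<epsilon> * ln (\<psi> m) \<le> - 4 * ln 4" using \<epsilon> by (simp add: field_simps)
        thus "\<epsilon> * ln (1 / \<psi> m) \<ge> 4 * ln 4" using p by (simp add: ln_div)
      qed (use \<kappa> \<kappa>1 \<epsilon> in auto)
      hence "(\<Sum>m=N..n. (4 - \<epsilon>) * f m - r) \<le> (\<Sum>m=N..n. q m)" by (intro sum_mono) auto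
      moreover have "(\<Sum>m=N..n. (4 - \<epsilon>) * f m - r) = (4 - \<epsilon>) * (\<Sum>m=N..n. f m) - real (card {N..n}) * r"
        by (simp add: sum_subtractf sum_distrib_left)
      moreover have "real (card {N..n}) * r \<le> real n * r" using r0 N by (intro mult_right_mono) auto
      moreover have "real n * r \<le> D"
        using perturbation_sum_bound[OF n1 \<epsilon>] unfolding r_def D_def \<kappa>_def mult.left_commute[of "real n" 4]
        by (rule mult_left_mono) simp
      moreover have "(\<Sum>m = 1..n. f m) = (\<Sum>m = 1..<N. f m) + (\<Sum>m=N..n. f m)"
        using sum.atLeastLessThan_concat[of 1 N "Suc n" f] n N by (simp add: atLeastLessThanSuc_atLeastAtMost)
      hence "(4 - \<epsilon>) * (\<Sum>m = 1..n. f m) = (4 - \<epsilon>) * (\<Sum>m = 1..<N. f m) + (4 - \<epsilon>) * (\<Sum>m=N..n. f m)"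
        by (simp only: distrib_left)
      ultimately have q: "(\<Sum>m=N..n. q m) \<ge> (4 - \<epsilon>) * (\<Sum>m = 1..n. f m) - C" unfolding C_def by linarith
      define P where "P = real n powr (4 + \<epsilon>)"
      define Q where "Q = exp ((4 - \<epsilon>) * (\<Sum>m = 1..n. f m))"
      have PQ: "P > 0" "Q > 0" using n1 by (auto simp: P_def Q_def)
      note A(3)
      also have "4 * real n powr (4 + \<epsilon>) * exp (- (\<Sum>m=N..n. q m)) \<le> 4 * P * exp (C - (4 - \<epsilon>) * (\<Sum>m = 1..n. f m))"
        using q unfolding P_def by (intro mult_left_mono) auto
      also have "\<dots> = 4 * P * exp C / Q" by (simp add: exp_diff Q_def)
      also have "\<dots> \<le> 1 / real (Suc k)"
        using B PQ unfolding P_def[symmetric] Q_def[symmetric] by (simp add: field_simps)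
      finally have "prob A \<le> 1 / real (Suc k)" .
      moreover have "bad N \<subseteq> A" using A(2) by (fastforce simp: bad_def)
      ultimately show ?thesis using A(1) by blast
    qed
    then obtain A where A: "\<And>k. A k \<in> events" "\<And>k. bad N \<subseteq> A k" "\<And>k. prob (A k) \<le> 1 / real (Suc k)"
      by metis
    \<comment> \<open>\<open>bad N\<close> does not depend on \<open>n\<close>, so it lies in all
      \<open>A k\<close>, whose intersection is null.\<close>
    have I: "(\<Inter>k. A k) \<in> events" using A(1) by auto
    have "prob (\<Inter>k. A k) \<le> 1 / real (Suc k)" for k
      using finite_measure_mono[of "\<Inter>k. A k" "A k"] A(1) A(3)[of k] by force
    hence "prob (\<Inter>k. A k) \<le> 0"
      by (intro LIMSEQ_le_const[OF LIMSEQ_inverse_real_of_nat[unfolded inverse_eq_divide]]) blast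
    hence "prob (\<Inter>k. A k) = 0" by (intro antisym measure_nonneg)
    hence "(\<Inter>k. A k) \<in> null_sets M" using I by (simp add: null_sets_def emeasure_eq_measure)
    thus ?thesis using A(2) by blast
  qed
  have "AE \<omega> in M. \<not> (\<exists>\<alpha> \<beta>. \<forall>m\<ge>max N (max 1 N\<^sub>0). \<psi> m < dist_prod \<alpha> \<beta> m \<omega>)" for N
  proof -
    obtain A where "A \<in> null_sets M" "bad (max N (max 1 N\<^sub>0)) \<subseteq> A"
      using main[of "max N (max 1 N\<^sub>0)"] by (meson max.cobounded1 max.cobounded2 order_trans)
    thus ?thesis by (intro AE_I'[of A]) (auto simp: bad_def)
  qed
  hence "AE \<omega> in M. \<forall>N. \<not> (\<exists>\<alpha> \<beta>. \<forall>m\<ge>max N (max 1 N\<^sub>0). \<psi> m < dist_prod \<alpha> \<beta> m \<omega>)"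
    by (simp add: AE_all_countable)
  thus ?thesis
  proof eventually_elim
    case (elim \<omega>)
    show ?case
    proof (intro allI)
      fix \<alpha> \<beta> :: real and N :: nat
      from elim obtain m where "m \<ge> max N (max 1 N\<^sub>0)" "\<not> \<psi> m < dist_prod \<alpha> \<beta> m \<omega>" by blast
      thus "\<exists>n\<ge>N. n \<ge> 1 \<and> dist_prod \<alpha> \<beta> n \<omega> \<le> \<psi> n" by (intro exI[of _ m]) auto
    qed
  qed
qed

text \<open>Replace \<psi> by a small constant \<open>d\<close> below it, which only makes hits
  rarer. The sum then grows linearly in \<open>n\<close>, and its exponential beats
  \<open>n powr 5\<close>, so the previous result applies with
  \<open>\<epsilon> = 1\<close>.\<close>

lemma AE_hits_of_lower_bound:
  fixes \<psi> :: "nat \<Rightarrow> real"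
  assumes "c > 0" "\<And>m. m \<ge> 1 \<Longrightarrow> c \<le> \<psi> m"
  shows "AE \<omega> in M. \<forall>\<alpha> \<beta>. \<forall>N. \<exists>n\<ge>N. n \<ge> 1 \<and> dist_prod \<alpha> \<beta> n \<omega> \<le> \<psi> n"
proof -
  define d where "d = min c (min (1/4) (exp (- 4 * ln 4 / 1)))"
  have d: "d > 0" "d \<le> c" "d \<le> 1/4" "d \<le> exp (- 4 * ln 4 / 1)" using assms by (auto simp: d_def)
  define l where "l = d * ln (1 / d)"
  have l: "l > 0" using d by (auto simp: l_def)
  have lim: "filterlim (\<lambda>n. 1 / real n powr (4 + 1) * exp ((4 - 1) * (real n * l))) at_top at_top"
    using l by real_asymp
  have "AE \<omega> in M. \<forall>\<alpha> \<beta>. \<forall>N. \<exists>n\<ge>N. n \<ge> 1 \<and> dist_prod \<alpha> \<beta> n \<omega> \<le> d"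
  proof (rule AE_hits_of_eventually_small[where \<epsilon> = 1 and N\<^sub>0 = 0 and \<psi> = "\<lambda>_. d"])
    fix B :: real and N :: nat
    have "eventually (\<lambda>n. n \<ge> N \<and> B \<le> 1 / real n powr (4 + 1) * exp ((4 - 1) * (real n * l))) at_top"
      using lim eventually_ge_at_top[of N] by (auto simp: filterlim_at_top eventually_conj_iff)
    thus "\<exists>n\<ge>N. B \<le> 1 / real n powr (4 + 1) * exp ((4 - 1) * (\<Sum>m = 1..n. d * ln (1 / d)))"
      using eventually_happens'[OF sequentially_bot] by (fastforce simp: l_def)
  qed (use d in auto)
  thus ?thesis
  proof eventually_elim
    case (elim \<omega>)
    thus ?case using d(2) assms(2) by (meson order_trans)
  qed
qed

section \<open>From hits to triples, and the final case distinction\<close>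

text \<open>Each hit \<open>n\<close> yields a triple by rounding
  \<open>n * \<alpha> + \<gamma> n \<omega>\<close> and
  \<open>n * \<beta> + \<delta> n \<omega>\<close>. Finitely many triples would leave only finitely
  many first components, hence a largest hit.\<close>

lemma infinite_triples:
  assumes "\<forall>N. \<exists>n\<ge>N. n \<ge> 1 \<and> dist_prod \<alpha> \<beta> n \<omega> \<le> \<psi> n"
  shows "infinite {(n :: nat, a :: int, b :: int). n \<ge> 1 \<and>
             \<bar>\<alpha> + \<gamma> n \<omega> / real n - real_of_int a / real n\<bar> *
             \<bar>\<beta> + \<delta> n \<omega> / real n - real_of_int b / real n\<bar> \<le> \<psi> n / (real n)\<^sup>2}" (is "infinite ?T")
proof
  assume "finite ?T"
  hence "finite (fst ` ?T)" by (rule finite_imageI)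
  moreover have "{n. n \<ge> 1 \<and> dist_prod \<alpha> \<beta> n \<omega> \<le> \<psi> n} \<subseteq> fst ` ?T"
  proof
    fix n assume "n \<in> {n. n \<ge> 1 \<and> dist_prod \<alpha> \<beta> n \<omega> \<le> \<psi> n}"
    hence n: "n \<ge> 1" "dist_prod \<alpha> \<beta> n \<omega> \<le> \<psi> n" by auto
    have scale: "\<bar>x + y / real n - of_int (round (real n * x + y)) / real n\<bar> = int_dist (real n * x + y) / real n" for x y
    proof -
      have "x + y / real n - of_int (round (real n * x + y)) / real n =
          (real n * x + y - of_int (round (real n * x + y))) / real n"
        using n(1) by (simp add: field_simps)
      thus ?thesis by (simp add: int_dist_def)
    qed
    have "(n, round (real n * \<alpha> + \<gamma> n \<omega>), round (real n * \<beta> + \<delta> n \<omega>)) \<in> ?T"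
      using n divide_right_mono[OF n(2), of "(real n)\<^sup>2"]
      by (simp add: scale dist_prod_def power2_eq_square)
    thus "n \<in> fst ` ?T" by force
  qed
  ultimately have "finite {n. n \<ge> 1 \<and> dist_prod \<alpha> \<beta> n \<omega> \<le> \<psi> n}" by (rule finite_subset[rotated])
  then obtain b where "\<forall>n. n \<ge> 1 \<and> dist_prod \<alpha> \<beta> n \<omega> \<le> \<psi> n \<longrightarrow> n < b"
    unfolding finite_nat_set_iff_bounded by auto
  thus False using assms by (meson not_less)
qed

end

lemma limsup_eq_PInf_unbounded:
  assumes "limsup (\<lambda>n. ereal (h n)) = \<infinity>"
  shows "\<exists>n\<ge>N. B \<le> h n"
proof (rule ccontr)
  assume "\<not> (\<exists>n\<ge>N. B \<le> h n)"
  hence "\<forall>\<^sub>F n in sequentially. ereal (h n) \<le> ereal B"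
    unfolding eventually_sequentially by (metis ereal_less_eq(3) less_imp_le linorder_not_le)
  hence "limsup (\<lambda>n. ereal (h n)) \<le> ereal B" by (rule Limsup_bounded)
  thus False using assms by simp
qed

theorem theorem2:
  fixes M :: "'a measure"
    and \<gamma> \<delta> :: "nat \<Rightarrow> 'a \<Rightarrow> real"
    and \<psi> :: "nat \<Rightarrow> real"
    and \<epsilon> :: real
  assumes "prob_space M"
    and "prob_space.indep_vars M (\<lambda>_. borel) (case_sum \<gamma> \<delta>) ({1..} <+> {1..})"
    and "\<And>n. n \<ge> 1 \<Longrightarrow> distr M borel (\<gamma> n) = uniform_measure lborel {0..<1}"
    and "\<And>n. n \<ge> 1 \<Longrightarrow> distr M borel (\<delta> n) = uniform_measure lborel {0..<1}"
    and "\<And>n. n \<ge> 1 \<Longrightarrow> \<psi> n \<ge> 0"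
    and "antimono_on {1..} \<psi>"
    and "\<epsilon> > 0"
    and "limsup (\<lambda>n. ereal (1 / real n powr (4 + \<epsilon>) *
           exp ((4 - \<epsilon>) * (\<Sum>m = 1..n. \<psi> m * ln (1 / \<psi> m))))) = \<infinity>"
  shows "AE \<omega> in M. \<forall>\<alpha> \<beta> :: real.
           infinite {(n :: nat, a :: int, b :: int). n \<ge> 1 \<and>
             \<bar>\<alpha> + \<gamma> n \<omega> / real n - real_of_int a / real n\<bar> *
             \<bar>\<beta> + \<delta> n \<omega> / real n - real_of_int b / real n\<bar> \<le> \<psi> n / (real n)\<^sup>2}"
proof -
  interpret uniform_shifts M \<gamma> \<delta>
    using assms(1-4) by (simp add: uniform_shifts_def uniform_shifts_axioms_def)
  define c where "c = min (1/4) (exp (- 4 * ln 4 / \<epsilon>))"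
  have c: "c > 0" by (simp add: c_def)
  have "AE \<omega> in M. \<forall>\<alpha> \<beta>. \<forall>N. \<exists>n\<ge>N. n \<ge> 1 \<and> dist_prod \<alpha> \<beta> n \<omega> \<le> \<psi> n"
  \<comment> \<open>By monotonicity, one value at most \<open>c\<close> makes all later ones at most
    \<open>c\<close>; otherwise \<open>c\<close> is a positive lower bound for \<psi> from index 1
    on.\<close>
  proof (cases "\<exists>m\<ge>1. \<psi> m \<le> c")
    case True
    then obtain k where k: "k \<ge> 1" "\<psi> k \<le> c" by blast
    have "0 \<le> \<psi> m \<and> \<psi> m \<le> 1/4 \<and> \<psi> m \<le> exp (- 4 * ln 4 / \<epsilon>)" if "m \<ge> k" for m
    proof -
      have "\<psi> m \<le> \<psi> k" using assms(6) that k(1) by (auto simp: monotone_on_def)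
      hence "\<psi> m \<le> c" using k(2) by simp
      thus ?thesis using assms(5)[of m] that k(1) by (simp add: c_def)
    qed
    thus ?thesis
      by (rule AE_hits_of_eventually_small[OF assms(7) _ limsup_eq_PInf_unbounded[OF assms(8)]])
  next
    case False
    thus ?thesis using AE_hits_of_lower_bound[OF c, of \<psi>] by force
  qed
  thus ?thesis by eventually_elim (intro allI infinite_triples, blast)
qed

end
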